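(* Let $n,h,\lambda,k,r_1,\dots,r_k$ be positive integers with $n>h$ such that $r_i\ge 2$ and $h$ divides $r_in$ for $1\le i\le k$, and $\sum_{i=1}^k r_i=\lambda\binom{n-1}{h-1}$. Then for every integer $\ell$ with $1\le\ell\le n$ there exists an $h$-uniform hypergraph $\mathcal G$ on an $\ell$-element vertex set $V$ containing a distinguished vertex $\alpha$, together with a $k$-edge-coloring, such that: (1) for $u\in V$ and $1\le i\le k$, $d_i(u)=r_i(n-\ell+1)$ if $u=\alpha$ and $d_i(u)=r_i$ if $u\ne\alpha$; (2) for every integer $p\ge 0$ and every subset $U\subseteq V\setminus\{\alpha\}$ with $|U|=h-p$, the number of edges of $\mathcal G$ equal to the multiset $\{\alpha^p\}\cup U$ is $\lambda\binom{n-\ell+1}{p}$; (3) for $1\le i\le k$, if $r_i\ge 2$ then $\mathcal G_i$ is connected.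
   Context: A hypergraph is a pair $(V,E)$, $V$ finite, $E$ a multiset of edges, each edge a multi-subset of $V$ (a vertex may occur several times in an edge). It is $h$-uniform if every edge has size $h$ counted with multiplicity. $\{\alpha^p\}\cup U$ denotes the multiset consisting of $p$ copies of $\alpha$ together with the elements of $U$. A $k$-edge-coloring assigns one of $k$ colors to each edge; $\mathcal G_i$ is the sub-hypergraph on $V$ formed by the edges of color $i$, and $d_i(u)$ is the degree of $u$ in $\mathcal G_i$, i.e. the total number of occurrences of $u$ among the edges of color $i$. A hypergraph is connected if any two vertices are joined by a sequence of vertices with consecutive ones lying in a common edge.
   Formalization: Condition (3) is asserted only when h ≥ 2 or ℓ = 1: for h = 1 and ℓ ≥ 2 all edges are single vertices, so no color class can be connected (e.g. n = 2, h = 1, λ = 2, k = 1, r_1 = 2, ℓ = 2); (1) and (2) are proved in all cases. *)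

theory Defs
  imports "HOL-Library.Multiset"
begin

definition hypergraph :: "'a set \<Rightarrow> 'a multiset multiset \<Rightarrow> bool" where
  "hypergraph V E \<longleftrightarrow> finite V \<and> (\<forall>e\<in>#E. set_mset e \<subseteq> V)"

definition uniform_edges :: "nat \<Rightarrow> 'a multiset multiset \<Rightarrow> bool" where
  "uniform_edges h E \<longleftrightarrow> (\<forall>e\<in>#E. size e = h)"

text \<open>Parallel edges may receive different colors, so a coloring cannot be a function of the
  edge as a multiset of vertices.  It is a multiset of pairs (edge, color) whose first components
  make up exactly the edge multiset; the colors are \<open>1, \<dots>, k\<close>.\<close>

definition edge_coloring ::
  "nat \<Rightarrow> 'a multiset multiset \<Rightarrow> ('a multiset \<times> nat) multiset \<Rightarrow> bool" where
  "edge_coloring k E C \<longleftrightarrow> image_mset fst C = E \<and> (\<forall>x\<in>#C. snd x \<in> {1..k})"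

definition color_class :: "('a multiset \<times> nat) multiset \<Rightarrow> nat \<Rightarrow> 'a multiset multiset" where
  "color_class C i = image_mset fst (filter_mset (\<lambda>x. snd x = i) C)"

definition vertex_degree :: "'a multiset multiset \<Rightarrow> 'a \<Rightarrow> nat" where
  "vertex_degree E u = (\<Sum>e\<in>#E. count e u)"

definition hypergraph_connected :: "'a set \<Rightarrow> 'a multiset multiset \<Rightarrow> bool" where
  "hypergraph_connected V E \<longleftrightarrow>
     (\<forall>u\<in>V. \<forall>v\<in>V. (u, v) \<in> {(x, y). x \<in> V \<and> y \<in> V \<and> (\<exists>e\<in>#E. x \<in># e \<and> y \<in># e)}\<^sup>*)"

end

theory Submission
  imports Defs "HOL-Library.Disjoint_Sets" Complex_Main
begin

text \<open>
  Induction on \<open>l\<close>: each step splits a new vertex off the amalgamated vertex \<open>\<alpha>\<close>, starting from the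
  hypergraph whose only vertex is \<open>\<alpha>\<close>. With \<open>m = n - l + 1\<close>, the new vertex should receive a
  fraction \<open>1/m\<close> of the occurrences of \<open>\<alpha>\<close> in every color and in every class of equal edges, and
  at most one from each edge. Such a choice is obtained by rounding the constant fractional choice
  along two laminar families of sets of edges: the classes of equal edges on one side; colors and
  blocks of a partition of each color on the other.

  To keep color \<open>i\<close> connected, partition its edges into blocks linked by vertices other than \<open>\<alpha>\<close>,
  each block containing \<open>\<alpha>\<close>. All \<open>m\<close> copies of \<open>\<alpha>\<close> and \<open>t\<close> blocks can be joined into one component
  only if the \<open>r i * m\<close> occurrences of \<open>\<alpha>\<close> number at least \<open>m + t - 1\<close>, and this inequality is
  preserved by the splitting once the union of the blocks in which \<open>\<alpha>\<close> occurs at least twice is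
  added to the second family.
\<close>

section \<open>Rounding along two laminar families\<close>

text \<open>Gaussian elimination: an equation with a nonzero coefficient at \<open>j\<close> is used
  to eliminate the unknown \<open>j\<close>, which leaves one equation and one unknown
  fewer.\<close>

lemma homogeneous_system_nontrivial_solution:
  fixes a :: "'e \<Rightarrow> 'i \<Rightarrow> real"
  assumes "finite E" "finite I" "card E < card I"
  shows "\<exists>d. (\<exists>i\<in>I. d i \<noteq> 0) \<and> (\<forall>e\<in>E. (\<Sum>i\<in>I. a e i * d i) = 0)"
  using assms
proof (induction E arbitrary: I a rule: finite_induct)
  case empty
  then show ?case by (intro exI[of _ "\<lambda>_. 1"]) (auto simp: card_gt_0_iff)
next
  case (insert e E)
  show ?case
  proof (cases "\<forall>i\<in>I. a e i = 0")
    case True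
    have "card E < card I" using insert by simp
    from insert.IH[OF \<open>finite I\<close> this] True show ?thesis by auto
  next
    case False
    then obtain j where j: "j \<in> I" "a e j \<noteq> 0" by blast
    have "card E < card (I - {j})" using insert j by simp
    from insert.IH[OF _ this, of "\<lambda>f i. a f i - a f j * a e i / a e j"] \<open>finite I\<close>
    obtain d where d: "\<exists>i\<in>I-{j}. d i \<noteq> 0"
      "\<And>f. f \<in> E \<Longrightarrow> (\<Sum>i\<in>I-{j}. (a f i - a f j * a e i / a e j) * d i) = 0" by auto
    define s where "s = (\<Sum>i\<in>I-{j}. a e i * d i)"
    \<comment> \<open>Equation \<open>e\<close> dictates this value at \<open>j\<close>.\<close>
    define d' where "d' = d(j := - s / a e j)"
    have sum': "(\<Sum>i\<in>I. a f i * d' i) = (\<Sum>i\<in>I-{j}. a f i * d i) - a f j * s / a e j" for f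
    proof -
      have "(\<Sum>i\<in>I. a f i * d' i) = a f j * d' j + (\<Sum>i\<in>I-{j}. a f i * d' i)"
        using j \<open>finite I\<close> by (simp add: sum.remove)
      also have "(\<Sum>i\<in>I-{j}. a f i * d' i) = (\<Sum>i\<in>I-{j}. a f i * d i)"
        by (rule sum.cong) (auto simp: d'_def)
      finally show ?thesis by (simp add: d'_def)
    qed
    have "(\<Sum>i\<in>I. a f i * d' i) = 0" if "f \<in> insert e E" for f
    proof (cases "f = e")
      case True
      then show ?thesis unfolding sum' using j by (simp add: s_def)
    next
      case False
      then have "(\<Sum>i\<in>I-{j}. (a f i - a f j * a e i / a e j) * d i) = 0" using d that by auto
      also have "(\<Sum>i\<in>I-{j}. (a f i - a f j * a e i / a e j) * d i)
        = (\<Sum>i\<in>I-{j}. a f i * d i) - (\<Sum>i\<in>I-{j}. (a f j / a e j) * (a e i * d i))"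
        unfolding sum_subtractf[symmetric] by (rule sum.cong) (auto simp: algebra_simps)
      also have "(\<Sum>i\<in>I-{j}. (a f j / a e j) * (a e i * d i)) = a f j * s / a e j"
        unfolding sum_distrib_left[symmetric] s_def by simp
      finally show ?thesis unfolding sum' .
    qed
    moreover have "\<exists>i\<in>I. d' i \<noteq> 0" using d(1) by (auto simp: d'_def)
    ultimately show ?thesis by blast
  qed
qed

section \<open>Laminar families and the rounding theorem\<close>

definition laminar :: "'a set set \<Rightarrow> bool" where
  "laminar \<A> \<longleftrightarrow> (\<forall>A\<in>\<A>. \<forall>B\<in>\<A>. A \<subseteq> B \<or> B \<subseteq> A \<or> A \<inter> B = {})"

lemma laminar_subset: "laminar \<B> \<Longrightarrow> \<A> \<subseteq> \<B> \<Longrightarrow> laminar \<A>"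
  unfolding laminar_def by blast

text \<open>The members containing \<open>h\<close> form a chain, since no two of them are disjoint,
  so a minimal one among them lies inside all the others.\<close>

lemma laminar_Inter_mem:
  assumes "finite \<A>" "laminar \<A>" "A \<in> \<A>" "h \<in> A"
  shows "\<Inter>{B \<in> \<A>. h \<in> B} \<in> \<A>"
proof -
  define \<B> where "\<B> = {B \<in> \<A>. h \<in> B}"
  have fin: "finite \<B>" "\<B> \<noteq> {}" using assms by (auto simp: \<B>_def)
  obtain B where B: "B \<in> \<B>" "\<And>C. C \<in> \<B> \<Longrightarrow> C \<subseteq> B \<Longrightarrow> C = B"
    using finite_has_minimal[OF fin] by blast
  have "B \<subseteq> C" if "C \<in> \<B>" for C
    using B that assms(2) unfolding laminar_def \<B>_def by blast
  then have "\<Inter>\<B> = B" using B(1) by blast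
  then show ?thesis using B(1) unfolding \<B>_def by auto
qed

text \<open>Labelling each point by the smallest member of the family containing it cuts every member
  into label classes.\<close>

lemma laminar_cells:
  assumes "finite H" "\<A> \<subseteq> Pow H" "laminar \<A>" "H \<in> \<A>"
    and int: "\<And>A. A \<in> \<A> \<Longrightarrow> sum x A \<in> (\<int> :: real set)"
  obtains a :: "'a \<Rightarrow> 'a set" where
    "\<And>c. sum x {h\<in>H. a h = c} \<in> \<int>"
    "\<And>d A. (\<And>c. sum d {h\<in>H. a h = c} = (0::real)) \<Longrightarrow> A \<in> \<A> \<Longrightarrow> sum d A = 0"
proof -
  define a where "a h = \<Inter>{B \<in> \<A>. h \<in> B}" for h
  have finA: "finite \<A>" using assms by (meson finite_Pow_iff finite_subset)
  have a_mem: "a h \<in> \<A>" if "h \<in> H" for h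
    using laminar_Inter_mem[OF finA assms(3,4) that] unfolding a_def .
  have h_mem: "h \<in> a h" for h unfolding a_def by blast
  \<comment> \<open>The label of a point of \<open>A\<close> lies inside \<open>A\<close>, and a
    point lies in its label. Hence \<open>A\<close> is the disjoint union of the classes whose
    labels are members inside \<open>A\<close>.\<close>
  have split: "sum f A = (\<Sum>B\<in>{B\<in>\<A>. B \<subseteq> A}. sum f {h\<in>H. a h = B})" if "A \<in> \<A>" for A and f :: "'a \<Rightarrow> real"
  proof -
    have *: "a ` A \<subseteq> {B\<in>\<A>. B \<subseteq> A}"
      using that a_mem assms(2) unfolding a_def by blast
    have "finite A" using that assms by (meson PowD finite_subset subsetD)
    then have "sum f A = (\<Sum>B\<in>{B\<in>\<A>. B \<subseteq> A}. sum f {h\<in>A. a h = B})"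
      using * finA by (intro sum.group[symmetric]) auto
    also have "\<dots> = (\<Sum>B\<in>{B\<in>\<A>. B \<subseteq> A}. sum f {h\<in>H. a h = B})"
    proof (rule sum.cong[OF refl])
      fix B assume "B \<in> {B\<in>\<A>. B \<subseteq> A}"
      then have "{h\<in>A. a h = B} = {h\<in>H. a h = B}"
        using h_mem that assms(2) by blast
      then show "sum f {h\<in>A. a h = B} = sum f {h\<in>H. a h = B}" by simp
    qed
    finally show ?thesis .
  qed
  \<comment> \<open>Induction over proper inclusion: the class with label \<open>A\<close> is what
    remains of \<open>A\<close> once the classes of smaller labels, whose sums are already integral,
    are removed.\<close>
  have 1: "sum x {h\<in>H. a h = A} \<in> \<int>" if "A \<in> \<A>" for A
  proof -
    have "finite A" using that assms by (meson PowD finite_subset subsetD)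
    then show ?thesis using that
    proof (induction A rule: finite_psubset_induct)
      case (psubset A)
      have "{B\<in>\<A>. B \<subseteq> A} = insert A {B\<in>\<A>. B \<subset> A}" using psubset by blast
      then have "sum x A = sum x {h\<in>H. a h = A} + (\<Sum>B\<in>{B\<in>\<A>. B \<subset> A}. sum x {h\<in>H. a h = B})"
        using split[OF psubset.prems, of x] finA by simp
      moreover have "(\<Sum>B\<in>{B\<in>\<A>. B \<subset> A}. sum x {h\<in>H. a h = B}) \<in> \<int>"
        by (rule Ints_sum) (use psubset.IH in blast)
      ultimately show ?case using int[OF psubset.prems] Ints_diff by fastforce
    qed
  qed
  have 2: "sum x {h\<in>H. a h = c} \<in> \<int>" for c
  proof (cases "c \<in> \<A>")
    case False
    then have "{h\<in>H. a h = c} = {}" using a_mem by auto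
    then show ?thesis by (simp only: sum.empty Ints_0)
  qed (rule 1)
  show ?thesis using 2 split by (intro that[of a]) auto
qed

text \<open>View the classes of \<open>a\<close> and of \<open>b\<close> as the two sides of a
  bipartite graph whose edges are the points with fractional \<open>x\<close>. Integral class sums
  exclude vertices of degree one, so a nonzero weighting with sum zero at every vertex exists; it is
  found by counting equations against unknowns.\<close>

lemma fractional_circulation:
  fixes x :: "'a \<Rightarrow> real" and a b :: "'a \<Rightarrow> 'b"
  assumes H: "finite H" and frac: "\<exists>h\<in>H. x h \<notin> \<int>"
    and a: "\<And>c. sum x {h\<in>H. a h = c} \<in> \<int>" and b: "\<And>c. sum x {h\<in>H. b h = c} \<in> \<int>"
  shows "\<exists>d :: 'a \<Rightarrow> real. (\<exists>h\<in>H. d h \<noteq> 0) \<and> (\<forall>h. x h \<in> \<int> \<longrightarrow> d h = 0) \<and>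
    (\<forall>c. sum d {h\<in>H. a h = c} = 0) \<and> (\<forall>c. sum d {h\<in>H. b h = c} = 0)"
proof -
  define F where "F = {h\<in>H. x h \<notin> \<int>}"
  have F: "finite F" "F \<noteq> {}" using H frac by (auto simp: F_def)
  have big: "2 * card (g ` F) \<le> card F" if g: "\<And>c. sum x {h\<in>H. g h = c} \<in> \<int>" for g :: "'a \<Rightarrow> 'b"
  proof -
    \<comment> \<open>A single fractional value in a class would make the class sum
      fractional.\<close>
    have two: "2 \<le> card {h\<in>F. g h = c}" if "c \<in> g ` F" for c
    proof (rule ccontr)
      assume *: "\<not> 2 \<le> card {h\<in>F. g h = c}"
      have "{h\<in>F. g h = c} \<noteq> {}" using that by auto
      then have "card {h\<in>F. g h = c} \<noteq> 0" using F by simp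
      then have "card {h\<in>F. g h = c} = 1" using * by simp
      then obtain h where h: "{h\<in>F. g h = c} = {h}" by (auto simp: card_1_singleton_iff)
      have "sum x {h\<in>H. g h = c} = sum x ({h\<in>H. g h = c} - F) + sum x {h\<in>F. g h = c}"
        using H by (subst sum.union_disjoint[symmetric]) (auto simp: F_def intro!: sum.cong)
      moreover have "sum x ({h\<in>H. g h = c} - F) \<in> \<int>"
        by (intro Ints_sum) (auto simp: F_def)
      ultimately have "sum x {h\<in>F. g h = c} \<in> \<int>" using g[of c] Ints_diff by fastforce
      moreover have "h \<in> F" using h by auto
      ultimately show False unfolding h by (simp add: F_def)
    qed
    have "card (g ` F) * 2 \<le> (\<Sum>c\<in>g ` F. card {h\<in>F. g h = c})"
      using sum_mono[OF two, of "g ` F" "\<lambda>c. c"] by simp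
    also have "\<dots> = card F" using sum.group[of F "g ` F" g "\<lambda>_. 1::nat"] F by simp
    finally show ?thesis by simp
  qed
  \<comment> \<open>Both systems of equations add up to the same total, so one equation can be dropped.\<close>
  obtain f where f: "f \<in> F" using F by blast
  define E where "E = Inl ` a ` F \<union> Inr ` (b ` F - {b f})"
  have "card E \<le> card (a ` F) + card (b ` F - {b f})"
    unfolding E_def by (rule order.trans[OF card_Un_le]) (use F in \<open>auto intro!: add_mono card_image_le\<close>)
  also have "\<dots> < card (a ` F) + card (b ` F)"
    using f F by (intro add_strict_left_mono psubset_card_mono) auto
  also have "\<dots> \<le> card F" using big[OF a] big[OF b] by simp
  finally have "card E < card F" .
  moreover have "finite E" using F by (auto simp: E_def)
  ultimately obtain d0 :: "'a \<Rightarrow> real" where d0: "\<exists>i\<in>F. d0 i \<noteq> 0"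
    "\<And>e. e \<in> E \<Longrightarrow> (\<Sum>i\<in>F. (case e of Inl c \<Rightarrow> of_bool (a i = c) | Inr c \<Rightarrow> of_bool (b i = c)) * d0 i) = 0"
    using homogeneous_system_nontrivial_solution[of E F
       "\<lambda>e i. (case e of Inl c \<Rightarrow> of_bool (a i = c) | Inr c \<Rightarrow> of_bool (b i = c))"] F by blast
  define d where "d h = (if h \<in> F then d0 h else 0)" for h
  have restr: "sum d {h\<in>H. g h = c} = (\<Sum>i\<in>F. of_bool (g i = c) * d0 i)" for g :: "'a \<Rightarrow> 'b" and c
  proof -
    have "sum d {h\<in>H. g h = c} = sum d {h\<in>F. g h = c}"
      using H by (intro sum.mono_neutral_right) (auto simp: d_def F_def)
    also have "\<dots> = (\<Sum>i\<in>F. if g i = c then d i else 0)" using F by (simp add: sum.inter_filter)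
    also have "\<dots> = (\<Sum>i\<in>F. of_bool (g i = c) * d0 i)" by (rule sum.cong) (auto simp: d_def)
    finally show ?thesis .
  qed
  have out: "sum d {h\<in>H. g h = c} = 0" if "c \<notin> g ` F" for g :: "'a \<Rightarrow> 'b" and c
    using that by (intro sum.neutral) (auto simp: d_def)
  have da: "sum d {h\<in>H. a h = c} = 0" for c
    using d0(2)[of "Inl c"] out[of c a] restr[of a c] by (cases "c \<in> a ` F") (auto simp: E_def)
  have db': "sum d {h\<in>H. b h = c} = 0" if "c \<noteq> b f" for c
    using d0(2)[of "Inr c"] out[of c b] restr[of b c] that by (cases "c \<in> b ` F") (auto simp: E_def)
  have "(\<Sum>c\<in>b ` H. sum d {h\<in>H. b h = c}) = (\<Sum>c\<in>a ` H. sum d {h\<in>H. a h = c})"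
    using H by (simp add: sum.group)
  also have "\<dots> = 0" using da by simp
  finally have "(\<Sum>c\<in>b ` H. sum d {h\<in>H. b h = c}) = 0" .
  moreover have "(\<Sum>c\<in>b ` H. sum d {h\<in>H. b h = c}) = sum d {h\<in>H. b h = b f} + (\<Sum>c\<in>b ` H - {b f}. sum d {h\<in>H. b h = c})"
    using H f by (intro sum.remove) (auto simp: F_def)
  moreover have "(\<Sum>c\<in>b ` H - {b f}. sum d {h\<in>H. b h = c}) = 0" using db' by (intro sum.neutral) auto
  ultimately have "sum d {h\<in>H. b h = c} = 0" for c using db' by (cases "c = b f") auto
  then show ?thesis using d0(1) da
    by (intro exI[of _ d]) (auto simp: d_def F_def)
qed

text \<open>Move from \<open>x\<close> in direction \<open>d\<close> until the first moving
  coordinate reaches its floor or ceiling. That coordinate was fractional, because \<open>d\<close>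
  vanishes at the integral ones.\<close>

lemma push_to_integral:
  fixes x d :: "'s \<Rightarrow> real"
  assumes "finite S" "\<exists>s\<in>S. d s \<noteq> 0" "\<And>s. s \<in> S \<Longrightarrow> x s \<in> \<int> \<Longrightarrow> d s = 0"
  obtains t where "\<And>s. s \<in> S \<Longrightarrow> \<lfloor>x s\<rfloor> \<le> x s + t * d s \<and> x s + t * d s \<le> \<lceil>x s\<rceil>"
    "\<exists>s\<in>S. x s \<notin> \<int> \<and> x s + t * d s \<in> \<int>"
proof -
  define D where "D = {s\<in>S. d s \<noteq> 0}"
  \<comment> \<open>The time at which coordinate \<open>s\<close> reaches the integer it moves
    towards: the ceiling for \<open>d s > 0\<close>, the floor for \<open>d s < 0\<close>.\<close>
  define w where "w s = (if d s > 0 then (\<lceil>x s\<rceil> - x s) / d s else (x s - \<lfloor>x s\<rfloor>) / (- d s))" for s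
  have D: "finite D" "D \<noteq> {}" using assms by (auto simp: D_def)
  define t where "t = Min (w ` D)"
  have "t \<in> w ` D" unfolding t_def using D by (intro Min_in) auto
  then obtain s0 where s0: "s0 \<in> D" "t = w s0" by blast
  have w0: "w s \<ge> 0" if "s \<in> D" for s
    using that by (auto simp: w_def D_def divide_nonneg_neg)
  have t: "0 \<le> t" "\<And>s. s \<in> D \<Longrightarrow> t \<le> w s"
    subgoal using w0[OF s0(1)] s0(2) by simp
    subgoal unfolding t_def using D(1) by (intro Min_le) auto
    done
  have "\<lfloor>x s\<rfloor> \<le> x s + t * d s \<and> x s + t * d s \<le> \<lceil>x s\<rceil>" if "s \<in> S" for s
  proof -
    consider "d s = 0" | "d s > 0" | "d s < 0" by linarith
    then show ?thesis
    proof cases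
      case 2
      then have "t \<le> (\<lceil>x s\<rceil> - x s) / d s" using t(2)[of s] that by (simp add: w_def D_def)
      then have "t * d s \<le> \<lceil>x s\<rceil> - x s" using 2 by (simp add: pos_le_divide_eq)
      moreover have "0 \<le> t * d s" using t 2 by simp
      ultimately show ?thesis using of_int_floor_le[of "x s"] by linarith
    next
      case 3
      then have "t \<le> (x s - \<lfloor>x s\<rfloor>) / (- d s)" using t(2)[of s] that by (simp add: w_def D_def)
      then have "t * (- d s) \<le> x s - \<lfloor>x s\<rfloor>" using 3 by (subst (asm) pos_le_divide_eq) auto
      moreover have "0 \<le> t * (- d s)" using t 3 by (intro mult_nonneg_nonneg) auto
      ultimately show ?thesis using le_of_int_ceiling[of "x s"] by (simp add: algebra_simps) linarith
    qed simp
  qed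
  moreover have "x s0 + t * d s0 \<in> \<int>" unfolding s0(2) w_def using s0(1) by (auto simp: D_def)
  ultimately show ?thesis using s0 assms(3)[of s0] by (intro that[of t]) (auto simp: D_def)
qed

text \<open>As long as some value is fractional, \<open>x\<close> can be moved in a direction that
  leaves all integral sums unchanged until one more sum becomes integral. The induction is on the
  number of fractional sums.\<close>

lemma laminar_rounding:
  fixes x :: "'a \<Rightarrow> real"
  assumes H: "finite H" and A: "\<A> \<subseteq> Pow H" "laminar \<A>" "H \<in> \<A>"
    and B: "\<B> \<subseteq> Pow H" "laminar \<B>" "H \<in> \<B>" and "sum x H \<in> \<int>"
  obtains y :: "'a \<Rightarrow> int" where "\<And>h. h \<in> H \<Longrightarrow> \<lfloor>x h\<rfloor> \<le> y h \<and> y h \<le> \<lceil>x h\<rceil>"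
    "\<And>S. S \<in> \<A> \<union> \<B> \<Longrightarrow> \<lfloor>sum x S\<rfloor> \<le> sum y S \<and> sum y S \<le> \<lceil>sum x S\<rceil>"
proof -
  \<comment> \<open>The singletons put the values of \<open>x\<close> under the same bounds as the
    sums, and they ensure that a nonzero \<open>d\<close> has a nonzero sum over some
    member.\<close>
  define \<S> where "\<S> = \<A> \<union> \<B> \<union> (\<lambda>h. {h}) ` H"
  have finS: "finite \<S>" using A B H unfolding \<S>_def by (auto intro: finite_subset[of _ "Pow H"])
  have "\<exists>y::'a \<Rightarrow> real. (\<forall>h\<in>H. y h \<in> \<int>) \<and> (\<forall>S\<in>\<S>. \<lfloor>sum x S\<rfloor> \<le> sum y S \<and> sum y S \<le> \<lceil>sum x S\<rceil>)"
    using \<open>sum x H \<in> \<int>\<close>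
  proof (induction "card {S\<in>\<S>. sum x S \<notin> \<int>}" arbitrary: x rule: less_induct)
    case less
    show ?case
    proof (cases "\<forall>h\<in>H. x h \<in> \<int>")
      case True
      then show ?thesis by (intro exI[of _ x]) auto
    next
      case False
      then have frac: "\<exists>h\<in>H. x h \<notin> \<int>" by blast
      \<comment> \<open>Only members with integral sum enter here, as these are the sums that must
        not move; \<open>H\<close> is one of them.\<close>
      obtain a :: "'a \<Rightarrow> 'a set" where a: "\<And>c. sum x {h\<in>H. a h = c} \<in> \<int>"
        "\<And>d A. (\<And>c. sum d {h\<in>H. a h = c} = (0::real)) \<Longrightarrow> A \<in> {A\<in>\<A>. sum x A \<in> \<int>} \<Longrightarrow> sum d A = 0"
        using laminar_cells[OF H, of "{A\<in>\<A>. sum x A \<in> \<int>}" x] A less.prems laminar_subset[OF A(2), of "{A\<in>\<A>. sum x A \<in> \<int>}"]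
        by blast
      obtain b :: "'a \<Rightarrow> 'a set" where b: "\<And>c. sum x {h\<in>H. b h = c} \<in> \<int>"
        "\<And>d A. (\<And>c. sum d {h\<in>H. b h = c} = (0::real)) \<Longrightarrow> A \<in> {A\<in>\<B>. sum x A \<in> \<int>} \<Longrightarrow> sum d A = 0"
        using laminar_cells[OF H, of "{A\<in>\<B>. sum x A \<in> \<int>}" x] B less.prems laminar_subset[OF B(2), of "{A\<in>\<B>. sum x A \<in> \<int>}"]
        by blast
      obtain d :: "'a \<Rightarrow> real" where d: "\<exists>h\<in>H. d h \<noteq> 0" "\<And>h. x h \<in> \<int> \<Longrightarrow> d h = 0"
        "\<And>c. sum d {h\<in>H. a h = c} = 0" "\<And>c. sum d {h\<in>H. b h = c} = 0"
        using fractional_circulation[OF H frac a(1) b(1)] by blast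
      have dS: "sum d S = 0" if "S \<in> \<S>" "sum x S \<in> \<int>" for S
        using that a(2)[OF d(3), of S] b(2)[OF d(4), of S] d(2) unfolding \<S>_def by auto
      have "\<exists>S\<in>\<S>. sum d S \<noteq> 0" using d(1) by (force simp: \<S>_def)
      from push_to_integral[OF finS this, of "sum x"] dS
      obtain t where t: "\<And>S. S \<in> \<S> \<Longrightarrow> \<lfloor>sum x S\<rfloor> \<le> sum x S + t * sum d S \<and> sum x S + t * sum d S \<le> \<lceil>sum x S\<rceil>"
        "\<exists>S\<in>\<S>. sum x S \<notin> \<int> \<and> sum x S + t * sum d S \<in> \<int>" by blast
      define z where "z h = x h + t * d h" for h
      have z: "sum z S = sum x S + t * sum d S" for S
        by (simp add: z_def sum.distrib sum_distrib_left)
      have keep: "sum z S \<in> \<int>" if "S \<in> \<S>" "sum x S \<in> \<int>" for S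
        using that dS z by simp
      have "{S\<in>\<S>. sum z S \<notin> \<int>} \<subset> {S\<in>\<S>. sum x S \<notin> \<int>}"
        using keep t(2) z by auto
      then have "card {S\<in>\<S>. sum z S \<notin> \<int>} < card {S\<in>\<S>. sum x S \<notin> \<int>}"
        using finS by (intro psubset_card_mono) auto
      moreover have "sum z H \<in> \<int>" using keep[of H] less.prems A by (auto simp: \<S>_def)
      ultimately obtain y :: "'a \<Rightarrow> real" where y: "\<forall>h\<in>H. y h \<in> \<int>"
        "\<forall>S\<in>\<S>. \<lfloor>sum z S\<rfloor> \<le> sum y S \<and> sum y S \<le> \<lceil>sum z S\<rceil>"
        using less.hyps[of z] by blast
      have "\<lfloor>sum x S\<rfloor> \<le> sum y S \<and> sum y S \<le> \<lceil>sum x S\<rceil>" if "S \<in> \<S>" for S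
      proof -
        \<comment> \<open>Since \<open>sum z S\<close> stays between the floor and the ceiling of
          \<open>sum x S\<close>, bounds for \<open>z\<close> imply bounds for
          \<open>x\<close>.\<close>
        have "\<lfloor>sum x S\<rfloor> \<le> \<lfloor>sum z S\<rfloor>" "\<lceil>sum z S\<rceil> \<le> \<lceil>sum x S\<rceil>"
          using t(1)[OF that] unfolding z by (simp_all add: le_floor_iff ceiling_le_iff)
        then show ?thesis using y(2) that by (smt (verit) of_int_le_iff)
      qed
      then show ?thesis using y(1) by blast
    qed
  qed
  then obtain y :: "'a \<Rightarrow> real" where y: "\<forall>h\<in>H. y h \<in> \<int>"
      "\<forall>S\<in>\<S>. \<lfloor>sum x S\<rfloor> \<le> sum y S \<and> sum y S \<le> \<lceil>sum x S\<rceil>" by blast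
  have fl: "real_of_int \<lfloor>y h\<rfloor> = y h" if "h \<in> H" for h
    using y(1) that by (auto elim!: Ints_cases)
  have fl': "real_of_int (\<Sum>h\<in>S. \<lfloor>y h\<rfloor>) = sum y S" if "S \<subseteq> H" for S
    using that fl by (auto simp: subset_iff intro!: sum.cong)
  have main: "\<lfloor>sum x S\<rfloor> \<le> (\<Sum>h\<in>S. \<lfloor>y h\<rfloor>) \<and> (\<Sum>h\<in>S. \<lfloor>y h\<rfloor>) \<le> \<lceil>sum x S\<rceil>" if "S \<in> \<S>" for S
  proof -
    have "S \<subseteq> H" using that A B by (auto simp: \<S>_def)
    then show ?thesis using y(2) that fl'[of S] by (metis of_int_le_iff)
  qed
  show ?thesis
    using main[of "{h}" for h] main
    by (intro that[of "\<lambda>h. \<lfloor>y h\<rfloor>"]) (auto simp: \<S>_def)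
qed

section \<open>Assembling laminar families, and selection by rounding\<close>

lemma laminar_insert_top: "laminar \<A> \<Longrightarrow> \<A> \<subseteq> Pow H \<Longrightarrow> laminar (insert H \<A>)"
  unfolding laminar_def by blast

lemma laminar_UN:
  assumes "\<And>i. i \<in> I \<Longrightarrow> laminar (\<F> i)" "\<And>i. i \<in> I \<Longrightarrow> \<F> i \<subseteq> Pow (K i)" "disjoint_family_on K I"
  shows "laminar (\<Union>i\<in>I. \<F> i)"
  unfolding laminar_def
proof (intro ballI)
  fix A B assume "A \<in> (\<Union>i\<in>I. \<F> i)" "B \<in> (\<Union>i\<in>I. \<F> i)"
  then obtain i j where ij: "i \<in> I" "A \<in> \<F> i" "j \<in> I" "B \<in> \<F> j" by blast
  then have sub: "A \<subseteq> K i" "B \<subseteq> K j" using assms(2) by blast+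
  show "A \<subseteq> B \<or> B \<subseteq> A \<or> A \<inter> B = {}"
  proof (cases "i = j")
    case True
    then show ?thesis using ij assms(1)[of i] unfolding laminar_def by blast
  next
    case False
    then have "K i \<inter> K j = {}" using assms(3) ij by (auto simp: disjoint_family_on_def)
    then show ?thesis using sub by blast
  qed
qed

text \<open>A block lies either inside the union of \<Q> or outside it. This allows the union of the
  heavy blocks, those of weight at least two, to join the blocks of a colour.\<close>

lemma laminar_disjoint_Union:
  assumes "disjoint P" "\<Q> \<subseteq> P"
  shows "laminar (insert (\<Union>\<Q>) P)"
proof -
  have *: "A = B \<or> A \<inter> B = {}" if "A \<in> P" "B \<in> P" for A B
    using assms(1) that by (auto simp: disjoint_def)
  have 1: "A \<subseteq> \<Union>\<Q> \<or> A \<inter> \<Union>\<Q> = {}" if "A \<in> P" for A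
    using *[OF that] assms(2) by blast
  have "A \<subseteq> B \<or> B \<subseteq> A \<or> A \<inter> B = {}" if "A = \<Union>\<Q> \<or> A \<in> P" "B = \<Union>\<Q> \<or> B \<in> P" for A B
    using that 1[of A] 1[of B] *[of A B] by (metis Int_commute order.refl)
  then show ?thesis unfolding laminar_def by (metis insert_iff)
qed

text \<open>Rounding the numbers \<open>p j / m\<close>, which lie between 0 and 1, yields the
  indicator of \<open>X\<close>. The inequalities say without division that
  \<open>card (X \<inter> S)\<close> differs from \<open>sum p S / m\<close> by less than one, so
  the two agree when \<open>m\<close> divides \<open>sum p S\<close>.\<close>

lemma laminar_selection:
  fixes p :: "'a \<Rightarrow> nat"
  assumes H: "finite H" and A: "\<A> \<subseteq> Pow H" "laminar \<A>" "H \<in> \<A>"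
    and B: "\<B> \<subseteq> Pow H" "laminar \<B>" "H \<in> \<B>" and m: "0 < m" "m dvd sum p H"
    and le: "\<And>j. j \<in> H \<Longrightarrow> p j \<le> m"
  shows "\<exists>X\<subseteq>H. (\<forall>j\<in>X. 0 < p j) \<and>
    (\<forall>S\<in>\<A> \<union> \<B>. sum p S < card (X \<inter> S) * m + m \<and> card (X \<inter> S) * m < sum p S + m)"
proof -
  define x where "x j = real (p j) / real m" for j
  have sumx: "sum x S = real (sum p S) / real m" for S
    by (simp add: x_def sum_divide_distrib)
  have "sum x H \<in> \<int>" unfolding sumx using m by (metis dvd_def nonzero_mult_div_cancel_left of_nat_0_eq_iff of_nat_mult Ints_of_nat not_gr_zero)
  then obtain y :: "'a \<Rightarrow> int" where y: "\<And>h. h \<in> H \<Longrightarrow> \<lfloor>x h\<rfloor> \<le> y h \<and> y h \<le> \<lceil>x h\<rceil>"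
    "\<And>S. S \<in> \<A> \<union> \<B> \<Longrightarrow> \<lfloor>sum x S\<rfloor> \<le> sum y S \<and> sum y S \<le> \<lceil>sum x S\<rceil>"
    using laminar_rounding[OF H A B, of x] by blast
  define X where "X = {j\<in>H. y j = 1}"
  have y01: "y j = of_bool (j \<in> X)" if "j \<in> H" for j
  proof -
    have "0 \<le> x j" "x j \<le> 1" using le[OF that] m by (auto simp: x_def)
    then have "0 \<le> \<lfloor>x j\<rfloor>" "\<lceil>x j\<rceil> \<le> 1" by (simp_all add: ceiling_le_iff)
    then have "0 \<le> y j" "y j \<le> 1" using y(1)[OF that] by linarith+
    then show ?thesis using that by (auto simp: X_def)
  qed
  have pos: "0 < p j" if "j \<in> X" for j
  proof (rule ccontr)
    assume "\<not> 0 < p j"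
    then show False using y(1)[of j] that by (auto simp: X_def x_def)
  qed
  have "sum p S < card (X \<inter> S) * m + m \<and> card (X \<inter> S) * m < sum p S + m" if "S \<in> \<A> \<union> \<B>" for S
  proof -
    have S: "S \<subseteq> H" "finite S" using that A B H by (auto intro: finite_subset)
    have "sum y S = (\<Sum>j\<in>S. of_bool (j \<in> X))"
      using S y01 by (intro sum.cong) auto
    also have "\<dots> = int (card (X \<inter> S))" using S by (simp add: Int_commute)
    finally have ys: "sum y S = int (card (X \<inter> S))" .
    have "sum x S < card (X \<inter> S) + 1" "card (X \<inter> S) < sum x S + 1"
      using y(2)[OF that] ys by linarith+
    then have "real (sum p S) < (card (X \<inter> S) + 1) * real m" "real (card (X \<inter> S)) * m < real (sum p S) + m"
      using m unfolding sumx by (simp_all add: field_simps)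
    then have "real (sum p S) < real (card (X \<inter> S) * m + m)" "real (card (X \<inter> S) * m) < real (sum p S + m)"
      by (simp_all add: algebra_simps)
    then show ?thesis using of_nat_less_iff by blast
  qed
  then show ?thesis using pos by (intro exI[of _ X]) (auto simp: X_def)
qed

section \<open>Weighted partitions\<close>

lemma sum_partition_on:
  fixes p :: "'j \<Rightarrow> nat"
  assumes "finite J" "partition_on J P"
  shows "sum p J = (\<Sum>W\<in>P. sum p W)"
proof -
  have "finite W" if "W \<in> P" for W
    using assms that by (auto simp: partition_on_def intro: finite_subset)
  then have "sum p (\<Union>P) = (\<Sum>W\<in>P. sum p W)"
    using assms sum.Union_disjoint[of P p] by (auto simp: partition_on_def disjoint_def)
  then show ?thesis using assms by (simp add: partition_on_def)
qed

lemma partition_on_merge: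
  assumes "partition_on J P" "Q \<subseteq> P" "Q \<noteq> {}"
  shows "partition_on J (insert (\<Union>Q) (P - Q))"
proof -
  have *: "A = B \<or> A \<inter> B = {}" if "A \<in> P" "B \<in> P" for A B
    using assms(1) that by (auto simp: disjoint_def partition_on_def)
  have "disjoint (insert (\<Union>Q) (P - Q))"
    unfolding disjoint_def using * assms(2) by blast
  moreover have "\<Union>(insert (\<Union>Q) (P - Q)) = J" using assms by (auto simp: partition_on_def)
  moreover have "\<Union>Q \<noteq> {}"
    using assms unfolding partition_on_def by (metis Union_empty_conv equals0I subsetD)
  ultimately show ?thesis using assms(1) by (auto simp: partition_on_def)
qed

text \<open>Blocks of weight one contribute equally to both sides of \<open>cnt\<close>. Dropping
  them leaves \<open>card L + m \<le> sum p (\<Union>L) + 1\<close> for the set \<open>L\<close> of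
  heavy blocks, which is nonempty because \<open>2 \<le> m\<close>. A selection of about
  \<open>1 / m\<close> of the weight is thus forced to meet a heavy block.\<close>

lemma heavy_blocks_weight:
  fixes p :: "'j \<Rightarrow> nat"
  assumes J: "finite J" and P: "partition_on J P" and pos: "\<And>W. W \<in> P \<Longrightarrow> 1 \<le> sum p W"
    and cnt: "card P + m \<le> sum p J + 1" and m: "2 \<le> m"
  shows "m \<le> sum p (\<Union>{W\<in>P. 2 \<le> sum p W})"
proof -
  define L where "L = {W\<in>P. 2 \<le> sum p W}"
  have finP: "finite P" using J P by (rule finite_elements)
  have PL: "partition_on (\<Union>L) L" "\<Union>L \<subseteq> J"
    using P by (auto simp: L_def partition_on_def disjoint_def)
  then have L: "sum p (\<Union>L) = (\<Sum>W\<in>L. sum p W)"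
    using J by (intro sum_partition_on) (auto intro: finite_subset)
  have "sum p J = (\<Sum>W\<in>P. sum p W)" using J P by (rule sum_partition_on)
  also have "\<dots> = (\<Sum>W\<in>L. sum p W) + (\<Sum>W\<in>P-L. sum p W)"
    using finP by (subst sum.subset_diff[of L]) (auto simp: L_def)
  also have "(\<Sum>W\<in>P-L. sum p W) = card (P - L)"
    using pos by (subst card_eq_sum, intro sum.cong) (force simp: L_def)+
  finally have eq: "sum p J = sum p (\<Union>L) + card (P - L)" using L by simp
  have "card P = card L + card (P - L)"
    using finP card_Un_disjoint[of L "P - L"] by (auto simp: L_def Un_Diff_cancel Un_absorb1)
  then have *: "card L + m \<le> sum p (\<Union>L) + 1" using eq cnt by simp
  show ?thesis
  proof (cases "card L = 0")
    case True
    then have "L = {}" using finP by (simp add: L_def)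
    then have False using * m by simp
    then show ?thesis ..
  next
    case False
    then show ?thesis using * unfolding L_def by simp
  qed
qed

text \<open>Splitting one vertex off \<open>\<alpha>\<close>: \<open>p\<close> counts the occurrences of \<open>\<alpha>\<close> in the edges of one colour,
  and the edges of \<open>X\<close> give up one occurrence each. If some block meets \<open>X\<close> twice, its weight
  exceeds \<open>m\<close>, so the merged block alone is heavy enough to preserve the inequality; otherwise \<open>X\<close> meets \<open>r\<close> blocks.\<close>

lemma merge_blocks:
  fixes p q :: "'j \<Rightarrow> nat"
  assumes J: "finite J" and P: "partition_on J P" and pos: "\<And>W. W \<in> P \<Longrightarrow> 1 \<le> sum p W"
    and tot: "sum p J = r * m" and cnt: "card P + m \<le> r * m + 1" and m: "2 \<le> m"
    and X: "X \<subseteq> J" "card X = r" and q: "\<And>j. j \<in> J \<Longrightarrow> q j + of_bool (j \<in> X) = p j"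
    and up: "\<And>W. W \<in> P \<Longrightarrow> card (X \<inter> W) * m < sum p W + m"
    and heavy: "X \<inter> \<Union>{W\<in>P. 2 \<le> sum p W} \<noteq> {}"
    and Q: "Q = {W\<in>P. X \<inter> W \<noteq> {}}" and P': "P' = insert (\<Union>Q) (P - Q)"
  shows "(\<forall>W\<in>P'. 1 \<le> sum q W) \<and> card P' + (m - 1) \<le> r * (m - 1) + 1"
proof -
  have finP: "finite P" using J P by (rule finite_elements)
  have sub: "W \<subseteq> J" if "W \<in> P" for W using that P by (auto simp: partition_on_def)
  have pq: "sum p W = sum q W + card (X \<inter> W)" if "W \<subseteq> J" for W
  proof -
    have "finite W" using that J by (rule finite_subset)
    have "sum p W = (\<Sum>j\<in>W. q j + of_bool (j \<in> X))" using q that by (intro sum.cong refl) (metis subsetD)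
    then show ?thesis using \<open>finite W\<close> by (simp add: sum.distrib Int_commute)
  qed
  have in_M: "sum q W \<le> sum q (\<Union>Q)" if "W \<in> Q" for W
  proof (rule sum_mono2)
    have "\<Union>Q \<subseteq> J" using sub by (auto simp: Q)
    then show "finite (\<Union>Q)" using J by (rule finite_subset)
  qed (use that in auto)
  obtain W0 where W0: "W0 \<in> P" "2 \<le> sum p W0" "X \<inter> W0 \<noteq> {}" using heavy by blast
  \<comment> \<open>If \<open>X\<close> exhausted \<open>W0\<close>, then \<open>up\<close> would
    give \<open>sum p W0 * m < sum p W0 + m\<close>, impossible for factors of at least 2. Hence the
    merged block keeps positive weight.\<close>
  have "card (X \<inter> W0) < sum p W0"
  proof (rule ccontr)
    assume "\<not> card (X \<inter> W0) < sum p W0"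
    then have "sum p W0 * m \<le> card (X \<inter> W0) * m" by simp
    then have *: "sum p W0 * m < sum p W0 + m" using up[OF W0(1)] by linarith
    obtain a b where "sum p W0 = Suc (Suc a)" "m = Suc (Suc b)"
      using W0(2) m that[of "sum p W0 - 2" "m - 2"] by simp
    then show False using * by simp
  qed
  then have "1 \<le> sum q W0" using pq[OF sub[OF W0(1)]] by simp
  then have M1: "1 \<le> sum q (\<Union>Q)" using in_M[of W0] W0 by (auto simp: Q)
  have rest: "1 \<le> sum q W" if "W \<in> P - Q" for W
    using that pos[of W] pq[of W] sub[of W] by (auto simp: Q)
  have "Q \<subseteq> P" "Q \<noteq> {}" using W0 by (auto simp: Q)
  then have part: "partition_on J P'" unfolding P' by (rule partition_on_merge[OF P])
  then have sumq: "sum q J = (\<Sum>W\<in>P'. sum q W)" using J by (intro sum_partition_on)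
  \<comment> \<open>The merged block meets \<open>X\<close> and the untouched ones do not, so it
    counts as one additional block.\<close>
  have notin: "\<Union>Q \<notin> P - Q"
  proof
    assume "\<Union>Q \<in> P - Q"
    then have "\<Union>Q \<inter> X = {}" by (auto simp: Q)
    then show False using W0 by (auto simp: Q)
  qed
  have cardP': "card P' = Suc (card (P - Q))" using notin finP by (simp add: P')
  have totq: "sum q J = r * (m - 1)"
    using pq[of J] tot X m by (simp add: Int_absorb2 algebra_simps diff_mult_distrib2)
  have r: "r * m = r * (m - 1) + r" using m by (cases m) auto
  have "card P' + (m - 1) \<le> r * (m - 1) + 1"
  proof (cases "\<exists>W\<in>P. 2 \<le> card (X \<inter> W)")
    case True
    then obtain W where W: "W \<in> P" "2 \<le> card (X \<inter> W)" by blast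
    then have "W \<in> Q" by (auto simp: Q)
    obtain a b where ab: "card (X \<inter> W) = Suc (Suc a)" "m = Suc b"
      using W(2) m that[of "card (X \<inter> W) - 2" "m - 1"] by simp
    \<comment> \<open>If \<open>X\<close> meets \<open>W\<close> in \<open>s \<ge> 2\<close> edges,
      then \<open>up\<close> makes the weight of \<open>W\<close> exceed \<open>(s - 1) * m\<close>.
      After the loss of \<open>s\<close> occurrences at least \<open>(s - 1) * (m - 1)\<close>
      remain.\<close>
    have "m - 1 \<le> sum q W"
      using up[OF W(1)] pq[OF sub[OF W(1)]] unfolding ab by simp
    then have "m - 1 \<le> sum q (\<Union>Q)" using in_M[OF \<open>W \<in> Q\<close>] by simp
    moreover have "card (P - Q) \<le> (\<Sum>W\<in>P-Q. sum q W)"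
      using sum_mono[of "P - Q" "\<lambda>_. 1::nat" "sum q"] rest by simp
    moreover have "sum q J = sum q (\<Union>Q) + (\<Sum>W\<in>P-Q. sum q W)"
      unfolding sumq unfolding P' using notin finP by simp
    ultimately show ?thesis using totq cardP' by simp
  next
    case False
    have "card (X \<inter> W) = of_bool (W \<in> Q)" if "W \<in> P" for W
    proof -
      have "finite (X \<inter> W)" using X J by (meson finite_Int finite_subset)
      moreover have "card (X \<inter> W) < 2" using False that by auto
      ultimately show ?thesis using that by (cases "X \<inter> W = {}") (auto simp: Q card_gt_0_iff less_2_cases_iff)
    qed
    then have "(\<Sum>W\<in>P. card (X \<inter> W)) = card Q"
      using finP \<open>Q \<subseteq> P\<close> by (simp add: Int_absorb1 Int_commute)
    moreover have "(\<Sum>W\<in>P. card (X \<inter> W)) = card X"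
    proof -
      have "(\<Sum>j\<in>W. of_bool (j \<in> X)) = card (X \<inter> W)" if "W \<subseteq> J" for W
        using finite_subset[OF that J] by (simp add: Int_commute)
      then have "(\<Sum>W\<in>P. card (X \<inter> W)) = (\<Sum>W\<in>P. \<Sum>j\<in>W. of_bool (j \<in> X))"
        using sub by (intro sum.cong refl) metis
      also have "\<dots> = (\<Sum>j\<in>J. of_bool (j \<in> X))" by (rule sum_partition_on[OF J P, symmetric])
      also have "\<dots> = card X" using X J by (simp add: Int_absorb1)
      finally show ?thesis .
    qed
    ultimately have "card Q = r" using X by simp
    moreover have "card (P - Q) = card P - card Q" "card Q \<le> card P"
      using \<open>Q \<subseteq> P\<close> finP finite_subset[of Q P] by (simp_all add: card_Diff_subset card_mono)
    \<comment> \<open>Merging \<open>r\<close> blocks into one loses \<open>r - 1\<close> of them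
      and \<open>m\<close> drops by one, so both sides of the inequality drop by exactly
      \<open>r\<close>.\<close>
    ultimately show ?thesis using cnt cardP' r m by simp
  qed
  then show ?thesis using M1 rest by (auto simp: P')
qed

section \<open>Splitting vertices off\<close>

text \<open>The edges are indexed by a set \<open>J\<close>, which together with the coloring \<open>c\<close> stays fixed while vertices
  are split off; only the edges \<open>e j\<close> change.\<close>

definition linked :: "'j set \<Rightarrow> ('j \<Rightarrow> 'v multiset) \<Rightarrow> 'v \<Rightarrow> ('j \<times> 'j) set" where
  "linked J e \<alpha> = {(i, j). i \<in> J \<and> j \<in> J \<and> (\<exists>v. v \<noteq> \<alpha> \<and> v \<in># e i \<and> v \<in># e j)}"

text \<open>The members of \<open>P\<close> need not be maximal linked sets: distinct ones may share vertices
  other than \<open>\<alpha>\<close>.\<close>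

definition wings :: "'j set \<Rightarrow> ('j \<Rightarrow> 'v multiset) \<Rightarrow> 'v \<Rightarrow> nat \<Rightarrow> nat \<Rightarrow> 'j set set \<Rightarrow> bool" where
  "wings J e \<alpha> m r P \<longleftrightarrow> (\<forall>W\<in>P. 1 \<le> (\<Sum>j\<in>W. count (e j) \<alpha>)) \<and> card P + m \<le> r * m + 1 \<and>
     (\<forall>W\<in>P. \<forall>i\<in>W. \<forall>j\<in>W. (i, j) \<in> (linked J e \<alpha>)\<^sup>*)"

text \<open>The invariant of the splitting; \<alpha> stands for \<open>m\<close> vertices that are
  still amalgamated. The guard \<open>2 \<le> h\<close> is there because for \<open>h = 1\<close>
  the construction starts with \<open>r i * n\<close> one-edge blocks and
  \<open>m = n \<ge> 2\<close>, which violates the inequality in \<open>wings\<close>.\<close>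

definition stage :: "nat \<Rightarrow> nat \<Rightarrow> nat \<Rightarrow> (nat \<Rightarrow> nat) \<Rightarrow> 'j set \<Rightarrow> ('j \<Rightarrow> nat) \<Rightarrow> 'v \<Rightarrow>
    'v set \<Rightarrow> nat \<Rightarrow> ('j \<Rightarrow> 'v multiset) \<Rightarrow> (nat \<Rightarrow> 'j set set) \<Rightarrow> bool" where
  "stage h lam k r J c \<alpha> V m e P \<longleftrightarrow>
     finite V \<and> \<alpha> \<in> V \<and>
     (\<forall>j\<in>J. \<exists>p U. U \<subseteq> V - {\<alpha>} \<and> card U + p = h \<and> e j = replicate_mset p \<alpha> + mset_set U) \<and>
     (\<forall>p U. U \<subseteq> V - {\<alpha>} \<and> card U + p = h \<longrightarrow>
        card {j\<in>J. e j = replicate_mset p \<alpha> + mset_set U} = lam * (m choose p)) \<and>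
     (\<forall>i\<in>{1..k}. \<forall>u\<in>V. (\<Sum>j | j \<in> J \<and> c j = i. count (e j) u) = (if u = \<alpha> then r i * m else r i)) \<and>
     (\<forall>i\<in>{1..k}. partition_on {j\<in>J. c j = i} (P i) \<and>
        (2 \<le> h \<longrightarrow> wings {j\<in>J. c j = i} e \<alpha> m (r i) (P i)))"

lemma count_mset_set_subset_Diff: "U \<subseteq> V - {\<alpha>} \<Longrightarrow> count (mset_set U) \<alpha> = 0"
  by (auto simp: count_mset_set')

text \<open>One laminar family holds the classes of equal edges, the other the colours, their blocks
  and the unions of their heavy blocks. Classes and colours contain \<alpha> a multiple of
  \<open>m\<close> times, so there the selection is exact; for blocks an upper bound
  suffices.\<close>

lemma stage_selection:
  assumes st: "stage h lam k r J c \<alpha> V m e P" and J: "finite J" and c: "c ` J \<subseteq> {1..k}" and m: "2 \<le> m"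
  shows "\<exists>X\<subseteq>J. (\<forall>j\<in>X. \<alpha> \<in># e j) \<and>
    (\<forall>t. card {j\<in>X. e j = t} * m = card {j\<in>J. e j = t} * count t \<alpha>) \<and>
    (\<forall>i\<in>{1..k}. card (X \<inter> {j\<in>J. c j = i}) = r i \<and>
      (\<forall>W\<in>P i. card (X \<inter> W) * m < (\<Sum>j\<in>W. count (e j) \<alpha>) + m) \<and>
      (2 \<le> h \<longrightarrow> X \<inter> \<Union>{W\<in>P i. 2 \<le> (\<Sum>j\<in>W. count (e j) \<alpha>)} \<noteq> {}))"
proof -
  define p where "p j = count (e j) \<alpha>" for j
  define K where "K i = {j\<in>J. c j = i}" for i
  define T where "T t = {j\<in>J. e j = t}" for t
  define L where "L i = \<Union>{W\<in>P i. 2 \<le> sum p W}" for i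
  define \<A> where "\<A> = insert J (range T)"
  define \<B> where "\<B> = insert J (\<Union>i\<in>{1..k}. insert (K i) (insert (L i) (P i)))"
  have part: "partition_on (K i) (P i)" if "i \<in> {1..k}" for i
    using st that unfolding stage_def K_def by blast
  have PK: "insert (L i) (P i) \<subseteq> Pow (K i)" if "i \<in> {1..k}" for i
    using part[OF that] by (auto simp: partition_on_def L_def)
  have A: "\<A> \<subseteq> Pow J" "laminar \<A>" "J \<in> \<A>"
    unfolding \<A>_def
    subgoal by (auto simp: T_def)
    subgoal by (rule laminar_insert_top) (auto simp: T_def laminar_def)
    subgoal by simp
    done
  have "laminar (insert (K i) (insert (L i) (P i)))" if "i \<in> {1..k}" for i
    unfolding L_def using PK[OF that] part[OF that]
    by (intro laminar_insert_top laminar_disjoint_Union) (auto simp: L_def partition_on_def)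
  then have "laminar (\<Union>i\<in>{1..k}. insert (K i) (insert (L i) (P i)))"
    using PK by (intro laminar_UN[where K = K]) (auto simp: disjoint_family_on_def K_def)
  moreover have sub: "(\<Union>i\<in>{1..k}. insert (K i) (insert (L i) (P i))) \<subseteq> Pow J"
    using PK by (fastforce simp: K_def)
  ultimately have B: "\<B> \<subseteq> Pow J" "laminar \<B>" "J \<in> \<B>"
    unfolding \<B>_def by (auto intro: laminar_insert_top)
  have degK: "sum p (K i) = r i * m" if "i \<in> {1..k}" for i
    using st that unfolding stage_def K_def p_def by auto
  have sumJ: "sum p J = (\<Sum>i\<in>{1..k}. sum p (K i))"
    unfolding K_def using J c by (intro sum.group[symmetric]) auto
  have dvdJ: "m dvd sum p J"
    unfolding sumJ by (rule dvd_sum) (simp add: degK)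
  have sumT: "sum p (T t) = card (T t) * count t \<alpha>" for t
    by (simp add: T_def p_def)
  have dvdT: "m dvd sum p (T t)" for t
  proof (cases "T t = {}")
    case False
    then obtain j where "j \<in> J" "e j = t" by (auto simp: T_def)
    then obtain q U where qU: "U \<subseteq> V - {\<alpha>}" "card U + q = h" "t = replicate_mset q \<alpha> + mset_set U"
      using st unfolding stage_def by blast
    then have "card (T t) = lam * (m choose q)" using st unfolding stage_def T_def by blast
    moreover have "count t \<alpha> = q" using qU by (simp add: count_mset_set_subset_Diff)
    ultimately have "sum p (T t) = lam * (q * (m choose q))" by (simp add: sumT)
    \<comment> \<open>Absorption: \<open>q * (m choose q) = m * ((m - 1) choose (q - 1))\<close> for
      positive \<open>q\<close>.\<close>
    also have "m dvd \<dots>" by (cases "q = 0") (auto simp: times_binomial_minus1_eq)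
    finally show ?thesis .
  qed simp
  \<comment> \<open>For \<open>q > m\<close> the prescribed count \<open>lam * (m choose q)\<close>
    is zero, so no edge contains \<alpha> more than \<open>m\<close> times.\<close>
  have le: "p j \<le> m" if "j \<in> J" for j
  proof (rule ccontr)
    assume "\<not> p j \<le> m"
    obtain q U where qU: "U \<subseteq> V - {\<alpha>}" "card U + q = h" "e j = replicate_mset q \<alpha> + mset_set U"
      using st \<open>j \<in> J\<close> unfolding stage_def by blast
    then have "card (T (e j)) = lam * (m choose q)" using st unfolding stage_def T_def by metis
    moreover have "p j = q" using qU by (simp add: p_def count_mset_set_subset_Diff)
    ultimately have "card (T (e j)) = 0" using \<open>\<not> p j \<le> m\<close> by simp
    then show False using J that by (auto simp: T_def)
  qed
  obtain X where X: "X \<subseteq> J" "\<And>j. j \<in> X \<Longrightarrow> 0 < p j"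
    "\<And>S. S \<in> \<A> \<union> \<B> \<Longrightarrow> sum p S < card (X \<inter> S) * m + m \<and> card (X \<inter> S) * m < sum p S + m"
    using laminar_selection[OF J A B _ dvdJ le] m by auto
  have exact: "card (X \<inter> S) * m = sum p S" if "S \<in> \<A> \<union> \<B>" "m dvd sum p S" for S
  proof -
    obtain d where d: "sum p S = d * m" using \<open>m dvd sum p S\<close> by (metis dvdE mult.commute)
    have "d * m < Suc (card (X \<inter> S)) * m" "card (X \<inter> S) * m < Suc d * m"
      using X(3)[OF that(1)] d by auto
    then have "d < Suc (card (X \<inter> S))" "card (X \<inter> S) < Suc d" by (metis mult_less_cancel2)+
    then show ?thesis using d by simp
  qed
  have 1: "card {j\<in>X. e j = t} * m = card {j\<in>J. e j = t} * count t \<alpha>" for t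
  proof -
    have "X \<inter> T t = {j\<in>X. e j = t}" using X by (auto simp: T_def)
    then show ?thesis using exact[of "T t"] dvdT[of t] sumT[of t] unfolding \<A>_def T_def by simp
  qed
  have 2: "card (X \<inter> {j\<in>J. c j = i}) = r i" if "i \<in> {1..k}" for i
  proof -
    have "K i \<in> \<B>" using that by (auto simp: \<B>_def)
    then have "card (X \<inter> K i) * m = r i * m" using exact[of "K i"] degK[OF that] by simp
    then show ?thesis using m unfolding K_def by simp
  qed
  have 3: "card (X \<inter> W) * m < (\<Sum>j\<in>W. count (e j) \<alpha>) + m" if "i \<in> {1..k}" "W \<in> P i" for i W
  proof -
    have "W \<in> \<B>" using that by (auto simp: \<B>_def)
    then show ?thesis using X(3)[of W] by (simp add: p_def)
  qed
  \<comment> \<open>The heavy blocks have total weight at least \<open>m\<close>, too much for a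
    selection that misses them.\<close>
  have 4: "X \<inter> \<Union>{W\<in>P i. 2 \<le> (\<Sum>j\<in>W. count (e j) \<alpha>)} \<noteq> {}" if i: "i \<in> {1..k}" and "2 \<le> h" for i
  proof -
    have "wings (K i) e \<alpha> m (r i) (P i)" using st that unfolding stage_def K_def by blast
    then have "m \<le> sum p (L i)" unfolding L_def wings_def
      using part[OF i] J degK[OF i] m by (intro heavy_blocks_weight[where J = "K i"]) (auto simp: p_def K_def)
    moreover have "L i \<in> \<B>" using i by (auto simp: \<B>_def)
    then have "sum p (L i) < card (X \<inter> L i) * m + m" using X(3)[of "L i"] by simp
    ultimately have "card (X \<inter> L i) \<noteq> 0" by (intro notI) simp
    then show ?thesis unfolding L_def p_def by auto
  qed
  show ?thesis using X 1 2 3 4 by (intro exI[of _ X]) (auto simp: p_def)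
qed


text \<open>Each selected edge trades one \<alpha> for the new vertex \<beta>. The edge counts
  follow Pascal's rule, and within a colour the blocks that meet the selection can be merged because
  \<beta> now links them.\<close>

lemma stage_step:
  assumes st: "stage h lam k r J c \<alpha> V m e P" and J: "finite J" and c: "c ` J \<subseteq> {1..k}" and m: "2 \<le> m"
    and r: "\<forall>i\<in>{1..k}. 1 \<le> r i" and \<beta>: "\<beta> \<notin> V"
  shows "\<exists>e' P'. stage h lam k r J c \<alpha> (insert \<beta> V) (m - 1) e' P'"
proof -
  obtain X where X: "X \<subseteq> J" "\<And>j. j \<in> X \<Longrightarrow> \<alpha> \<in># e j"
    and Xt: "\<And>t. card {j\<in>X. e j = t} * m = card {j\<in>J. e j = t} * count t \<alpha>"
    and Xc: "\<And>i. i \<in> {1..k} \<Longrightarrow> card (X \<inter> {j\<in>J. c j = i}) = r i"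
    and XW: "\<And>i W. i \<in> {1..k} \<Longrightarrow> W \<in> P i \<Longrightarrow> card (X \<inter> W) * m < (\<Sum>j\<in>W. count (e j) \<alpha>) + m"
    and XL: "\<And>i. i \<in> {1..k} \<Longrightarrow> 2 \<le> h \<Longrightarrow> X \<inter> \<Union>{W\<in>P i. 2 \<le> (\<Sum>j\<in>W. count (e j) \<alpha>)} \<noteq> {}"
    using stage_selection[OF st J c m] by blast
  define e' where "e' j = (if j \<in> X then add_mset \<beta> (e j - {#\<alpha>#}) else e j)" for j
  define K where "K i = {j\<in>J. c j = i}" for i
  define Q where "Q i = {W\<in>P i. (X \<inter> K i) \<inter> W \<noteq> {}}" for i
  define P' where "P' i = insert (\<Union>(Q i)) (P i - Q i)" for i
  have V: "finite V" "\<alpha> \<in> V" "\<alpha> \<noteq> \<beta>" using st \<beta> by (auto simp: stage_def)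
  have form: "\<exists>p U. U \<subseteq> V - {\<alpha>} \<and> card U + p = h \<and> e j = replicate_mset p \<alpha> + mset_set U" if "j \<in> J" for j
    using st that unfolding stage_def by blast
  have cnt: "card {j\<in>J. e j = replicate_mset p \<alpha> + mset_set U} = lam * (m choose p)"
    if "U \<subseteq> V - {\<alpha>}" "card U + p = h" for p U
    using st that unfolding stage_def by blast
  have deg: "(\<Sum>j\<in>K i. count (e j) u) = (if u = \<alpha> then r i * m else r i)" if "i \<in> {1..k}" "u \<in> V" for i u
    using st that unfolding stage_def K_def by blast
  have part: "partition_on (K i) (P i)" if "i \<in> {1..k}" for i
    using st that unfolding stage_def K_def by blast
  have finU: "finite U" if "U \<subseteq> V - {\<alpha>}" for U using that V by (meson Diff_subset finite_subset)
  have \<beta>e: "\<beta> \<notin># e j" if j: "j \<in> J" for j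
  proof -
    obtain p U where pU: "U \<subseteq> V - {\<alpha>}" "e j = replicate_mset p \<alpha> + mset_set U" using form[OF j] by blast
    then have "\<beta> \<notin> U" using \<beta> by blast
    then show ?thesis using pU V finU[OF pU(1)] by (auto simp: in_replicate_mset)
  qed
  have c\<alpha>: "count (e' j) \<alpha> + of_bool (j \<in> X) = count (e j) \<alpha>" for j
    using X(2)[of j] V by (auto simp: e'_def)
  have c\<beta>: "count (e' j) \<beta> = of_bool (j \<in> X)" if "j \<in> J" for j
    using \<beta>e[OF that] V by (auto simp: e'_def not_in_iff)
  have cu: "count (e' j) u = count (e j) u" if "u \<noteq> \<alpha>" "u \<noteq> \<beta>" for j u
    using that by (auto simp: e'_def)
  have form': "\<exists>p U. U \<subseteq> insert \<beta> V - {\<alpha>} \<and> card U + p = h \<and> e' j = replicate_mset p \<alpha> + mset_set U"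
    if j: "j \<in> J" for j
  proof -
    obtain p U where pU: "U \<subseteq> V - {\<alpha>}" "card U + p = h" "e j = replicate_mset p \<alpha> + mset_set U"
      using form[OF j] by blast
    show ?thesis
    proof (cases "j \<in> X")
      case True
      have "count (e j) \<alpha> = p" using pU by (simp add: count_mset_set_subset_Diff)
      then have "p \<noteq> 0" using X(2)[OF True] by (metis not_in_iff)
      then obtain q where q: "p = Suc q" by (cases p) auto
      have "\<beta> \<notin> U" using pU(1) \<beta> by blast
      then have "e' j = replicate_mset q \<alpha> + mset_set (insert \<beta> U)"
        using True pU finU[OF pU(1)] q by (simp add: e'_def)
      moreover have "card (insert \<beta> U) + q = h" using \<open>\<beta> \<notin> U\<close> pU finU[OF pU(1)] q by simp
      moreover have "insert \<beta> U \<subseteq> insert \<beta> V - {\<alpha>}" using pU V by auto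
      ultimately show ?thesis by blast
    next
      case False
      then show ?thesis using pU by (intro exI[of _ p] exI[of _ U]) (auto simp: e'_def)
    qed
  qed
  obtain n where n: "m = Suc n" using m by (cases m) auto
  \<comment> \<open>A share of \<open>p / m\<close> of the \<open>lam * (m choose p)\<close> edges,
    where \<open>n = m - 1\<close>. The case \<open>p = 0\<close> stands apart: there
    \<open>p - 1\<close> truncates to 0 and the formula would give \<open>lam\<close>.\<close>
  have cardX: "card {j\<in>X. e j = replicate_mset p \<alpha> + mset_set U} = (if p = 0 then 0 else lam * (n choose (p - 1)))"
    if U: "U \<subseteq> V - {\<alpha>}" "card U + p = h" for p U
  proof -
    have "card {j\<in>X. e j = replicate_mset p \<alpha> + mset_set U} * m = lam * (p * (m choose p))"
      using Xt[of "replicate_mset p \<alpha> + mset_set U"] cnt[OF U] U(1)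
      by (simp add: count_mset_set_subset_Diff)
    also have "\<dots> = (if p = 0 then 0 else lam * (n choose (p - 1))) * m"
      using times_binomial_minus1_eq[of p m] n by (simp add: algebra_simps)
    finally show ?thesis using n by (simp only: mult_cancel2) simp
  qed
  have cnt': "card {j\<in>J. e' j = replicate_mset p \<alpha> + mset_set U} = lam * ((m - 1) choose p)"
    if U: "U \<subseteq> insert \<beta> V - {\<alpha>}" "card U + p = h" for p U
  proof (cases "\<beta> \<in> U")
    \<comment> \<open>Edges without \<beta> are the unselected ones of the old class, and Pascal's
      rule gives the difference.\<close>
    case False
    then have UV: "U \<subseteq> V - {\<alpha>}" using U by blast
    define t where "t = replicate_mset p \<alpha> + mset_set U"
    have "\<beta> \<notin># t" using False V finU[OF UV] by (auto simp: t_def in_replicate_mset)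
    then have "e' j \<noteq> t" if "j \<in> X" for j using that by (auto simp: e'_def)
    moreover have "e' j = e j" if "j \<notin> X" for j using that by (simp add: e'_def)
    ultimately have "{j\<in>J. e' j = t} = {j\<in>J. e j = t} - {j\<in>X. e j = t}" by fastforce
    then have "card {j\<in>J. e' j = t} = card {j\<in>J. e j = t} - card {j\<in>X. e j = t}"
      using X(1) J by (subst card_Diff_subset[symmetric]) (auto intro: finite_subset)
    also have "\<dots> = lam * (m choose p) - (if p = 0 then 0 else lam * (n choose (p - 1)))"
      using cnt[OF UV U(2)] cardX[OF UV U(2)] by (simp add: t_def)
    also have "\<dots> = lam * (n choose p)"
      using n by (cases p) (auto simp: add_mult_distrib2)
    finally show ?thesis using n by (simp add: t_def)
  next
    case True
    define U0 where "U0 = U - {\<beta>}"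
    have U0: "U0 \<subseteq> V - {\<alpha>}" "\<beta> \<notin> U0" "U = insert \<beta> U0" using U True by (auto simp: U0_def)
    then have fin: "finite U0" using finU by blast
    \<comment> \<open>Edges with \<beta> are exactly the selected edges that had one more
      \<alpha>.\<close>
    have "{j\<in>J. e' j = replicate_mset p \<alpha> + mset_set U} = {j\<in>X. e j = replicate_mset (Suc p) \<alpha> + mset_set U0}"
    proof (intro equalityI subsetI; clarsimp)
      fix j assume j: "j \<in> J" "e' j = replicate_mset p \<alpha> + mset_set U"
      have "count (e' j) \<beta> \<noteq> 0" unfolding j(2) using U0 fin by simp
      then have jX: "j \<in> X" using c\<beta>[OF j(1)] by (metis of_bool_eq(1))
      then have "add_mset \<beta> (e j - {#\<alpha>#}) = add_mset \<beta> (replicate_mset p \<alpha> + mset_set U0)"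
        using j(2) U0 fin by (simp add: e'_def)
      then have "e j - {#\<alpha>#} = replicate_mset p \<alpha> + mset_set U0" by simp
      then show "j \<in> X \<and> e j = add_mset \<alpha> (replicate_mset p \<alpha> + mset_set U0)"
        using jX X(2)[OF jX] by (metis insert_DiffM)
    next
      fix j assume "j \<in> X" "e j = add_mset \<alpha> (replicate_mset p \<alpha> + mset_set U0)"
      then show "j \<in> J \<and> e' j = replicate_mset p \<alpha> + mset_set U"
        using X(1) U0 fin by (auto simp: e'_def)
    qed
    moreover have "card U0 + Suc p = h" using U U0 fin by simp
    ultimately show ?thesis using cardX[OF U0(1), of "Suc p"] n by simp
  qed
  have deg': "(\<Sum>j\<in>K i. count (e' j) u) = (if u = \<alpha> then r i * (m - 1) else r i)"
    if i: "i \<in> {1..k}" and u: "u \<in> insert \<beta> V" for i u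
  proof -
    have fin: "finite (K i)" using J by (simp add: K_def)
    have XK: "(\<Sum>j\<in>K i. of_bool (j \<in> X)) = r i" using Xc[OF i] fin by (simp add: K_def[symmetric] Int_commute)
    consider "u = \<alpha>" | "u = \<beta>" | "u \<in> V" "u \<noteq> \<alpha>" "u \<noteq> \<beta>" using u by blast
    then show ?thesis
    proof cases
      case 1
      have "(\<Sum>j\<in>K i. count (e' j) \<alpha>) + (\<Sum>j\<in>K i. of_bool (j \<in> X)) = (\<Sum>j\<in>K i. count (e j) \<alpha>)"
        unfolding sum.distrib[symmetric] c\<alpha> ..
      then show ?thesis using 1 XK deg[OF i V(2)] n by simp
    next
      case 2
      have "(\<Sum>j\<in>K i. count (e' j) \<beta>) = (\<Sum>j\<in>K i. of_bool (j \<in> X))"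
        using c\<beta> by (intro sum.cong) (auto simp: K_def)
      then show ?thesis using 2 XK V by simp
    next
      case 3
      then show ?thesis using deg[OF i 3(1)] cu by simp
    qed
  qed
  have part': "partition_on (K i) (P' i)" if i: "i \<in> {1..k}" for i
  proof -
    \<comment> \<open>As \<open>r i\<close> is positive, some edge of colour \<open>i\<close> is
      selected, so there is a block to merge.\<close>
    have "X \<inter> K i \<noteq> {}" using Xc[OF i] r i unfolding K_def by (metis card.empty not_one_le_zero)
    moreover have "K i = \<Union>(P i)" using part[OF i] by (auto simp: partition_on_def)
    ultimately have "Q i \<noteq> {}" unfolding Q_def by blast
    then show ?thesis unfolding P'_def using part[OF i] by (intro partition_on_merge) (auto simp: Q_def)
  qed
  have wings': "wings (K i) e' \<alpha> (m - 1) (r i) (P' i)" if i: "i \<in> {1..k}" and h: "2 \<le> h" for i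
  proof -
    have w: "wings (K i) e \<alpha> m (r i) (P i)" using st i h unfolding stage_def K_def by blast
    have WK: "W \<subseteq> K i" if "W \<in> P i" for W using part[OF i] that by (auto simp: partition_on_def)
    have XKW: "X \<inter> K i \<inter> W = X \<inter> W" if "W \<in> P i" for W using WK[OF that] by blast
    have "X \<inter> K i \<inter> \<Union>{W\<in>P i. 2 \<le> (\<Sum>j\<in>W. count (e j) \<alpha>)} \<noteq> {}"
      using XL[OF i h] WK by blast
    then have 1: "(\<forall>W\<in>P' i. 1 \<le> (\<Sum>j\<in>W. count (e' j) \<alpha>)) \<and> card (P' i) + (m - 1) \<le> r i * (m - 1) + 1"
      using w part[OF i] J m deg[OF i V(2)] Xc[OF i] c\<alpha> XW[OF i] XKW
      by (intro merge_blocks[where J = "K i" and P = "P i" and X = "X \<inter> K i" and Q = "Q i" and p = "\<lambda>j. count (e j) \<alpha>"])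
        (auto simp: wings_def Q_def P'_def K_def)
    \<comment> \<open>An edge loses at most one \<alpha>, and links use other vertices, so old links
      survive.\<close>
    have mono: "(linked (K i) e \<alpha>)\<^sup>* \<subseteq> (linked (K i) e' \<alpha>)\<^sup>*"
    proof (intro rtrancl_mono subsetI)
      fix z assume "z \<in> linked (K i) e \<alpha>"
      then obtain a b v where z: "z = (a, b)" "a \<in> K i" "b \<in> K i" "v \<noteq> \<alpha>" "v \<in># e a" "v \<in># e b"
        by (auto simp: linked_def)
      then have "v \<in># e' a" "v \<in># e' b" by (auto simp: e'_def in_diff_count)
      then show "z \<in> linked (K i) e' \<alpha>" using z by (auto simp: linked_def)
    qed
    have old: "(a, b) \<in> (linked (K i) e' \<alpha>)\<^sup>*" if "W \<in> P i" "a \<in> W" "b \<in> W" for a b W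
      using that w mono unfolding wings_def by blast
    have new: "(a, b) \<in> linked (K i) e' \<alpha>" if "a \<in> X \<inter> K i" "b \<in> X \<inter> K i" for a b
      using that V by (auto simp: linked_def e'_def intro!: exI[of _ \<beta>])
    have "(a, b) \<in> (linked (K i) e' \<alpha>)\<^sup>*" if W: "W \<in> P' i" "a \<in> W" "b \<in> W" for a b W
    proof (cases "W \<in> P i")
      case True
      then show ?thesis using old W by blast
    next
      case False
      then have "W = \<Union>(Q i)" using W by (auto simp: P'_def)
      then obtain A B where AB: "A \<in> Q i" "B \<in> Q i" "a \<in> A" "b \<in> B" using W by blast
      \<comment> \<open>The route from \<open>a\<close> to \<open>b\<close> runs inside the old
        block \<open>A\<close> to the selected edge \<open>x\<close>, through \<beta> to the
        selected edge \<open>y\<close>, and inside \<open>B\<close> to \<open>b\<close>.\<close>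
      then obtain x y where xy: "x \<in> X \<inter> K i" "x \<in> A" "y \<in> X \<inter> K i" "y \<in> B" by (auto simp: Q_def)
      have "(a, x) \<in> (linked (K i) e' \<alpha>)\<^sup>*" "(y, b) \<in> (linked (K i) e' \<alpha>)\<^sup>*"
        using AB xy old by (auto simp: Q_def)
      then show ?thesis using new[OF xy(1,3)] by (meson rtrancl.rtrancl_into_rtrancl rtrancl_trans)
    qed
    then show ?thesis using 1 unfolding wings_def by blast
  qed
  show ?thesis
    using V form' cnt' deg' part' wings'
    by (intro exI[of _ e'] exI[of _ P']) (simp add: stage_def K_def)
qed


section \<open>The initial hypergraph and the iteration\<close>

text \<open>Edges are indexed by pairs of a colour and a number, so that \<open>fst\<close> is the
  coloring. At the start every edge is a block of its own.\<close>

lemma stage_init: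
  fixes n h lam k :: nat and r :: "nat \<Rightarrow> nat" and \<alpha> :: 'v
  assumes "0 < h" and dvd: "\<forall>i\<in>{1..k}. 2 \<le> r i \<and> h dvd r i * n" and "h < n"
    and sum: "(\<Sum>i = 1..k. r i) = lam * ((n - 1) choose (h - 1))"
    and J: "J = (SIGMA i:{1..k}. {..<r i * n div h})"
  shows "stage h lam k r J fst \<alpha> {\<alpha>} n (\<lambda>_. replicate_mset h \<alpha>) (\<lambda>i. (\<lambda>j. {j}) ` {j\<in>J. fst j = i})"
proof -
  have K: "{j\<in>J. fst j = i} = {i} \<times> {..<r i * n div h}" if "i \<in> {1..k}" for i
    using that by (auto simp: J)
  have cardK: "card {j\<in>J. fst j = i} * h = r i * n" if "i \<in> {1..k}" for i
    using dvd that by (simp add: K)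
  \<comment> \<open>Counting occurrences of \<alpha> by colour, followed by absorption, gives the
    required number of edges.\<close>
  have "h * card J = (\<Sum>i = 1..k. r i * n)"
    using dvd by (simp add: J sum_distrib_left)
  also have "\<dots> = lam * (n * ((n - 1) choose (h - 1)))"
    using sum by (simp flip: sum_distrib_right)
  also have "\<dots> = h * (lam * (n choose h))" using times_binomial_minus1_eq[of h n] \<open>0 < h\<close> by simp
  finally have cardJ: "card J = lam * (n choose h)" using \<open>0 < h\<close> by simp
  have w: "wings {j\<in>J. fst j = i} (\<lambda>_. replicate_mset h \<alpha>) \<alpha> n (r i) ((\<lambda>j. {j}) ` {j\<in>J. fst j = i})"
    if i: "i \<in> {1..k}" and h: "2 \<le> h" for i
  proof -
    define q where "q = card {j\<in>J. fst j = i}"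
    \<comment> \<open>Two bounds by half of \<open>r i * n\<close>: the number of blocks because
      \<open>2 \<le> h\<close>, and \<open>n\<close> because \<open>2 \<le> r i\<close>.\<close>
    have "q * 2 \<le> q * h" using h by simp
    also have "\<dots> = r i * n" using cardK[OF i] by (simp add: q_def)
    finally have "q * 2 \<le> r i * n" .
    moreover have "2 * n \<le> r i * n" using dvd i by (intro mult_right_mono) auto
    ultimately have "q + n \<le> r i * n + 1" by linarith
    moreover have "card ((\<lambda>j. {j}) ` {j\<in>J. fst j = i}) = q"
      unfolding q_def by (rule card_image) simp
    ultimately show ?thesis using \<open>0 < h\<close> by (auto simp: wings_def)
  qed
  have "partition_on A ((\<lambda>j. {j}) ` A)" for A :: "(nat \<times> nat) set"
    by (auto simp: partition_on_def disjoint_def)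
  then show ?thesis using w cardJ cardK by (auto simp: stage_def)
qed

lemma stage_exists:
  fixes n h lam k l :: nat and r :: "nat \<Rightarrow> nat"
  assumes "0 < h" and r: "\<forall>i\<in>{1..k}. 2 \<le> r i \<and> h dvd r i * n" and "h < n"
    and "(\<Sum>i = 1..k. r i) = lam * ((n - 1) choose (h - 1))"
    and J: "J = (SIGMA i:{1..k}. {..<r i * n div h})" and "1 \<le> l" "l \<le> n"
  shows "\<exists>e P. stage h lam k r J fst (0::nat) {..<l} (n - l + 1) e P"
  using \<open>1 \<le> l\<close> \<open>l \<le> n\<close>
proof (induction l rule: dec_induct)
  case base
  have "{..<1} = {0::nat}" by auto
  then show ?case using stage_init[OF assms(1-5), of 0] assms(3) by auto
next
  case (step l)
  then obtain e P where st: "stage h lam k r J fst 0 {..<l} (n - l + 1) e P" by auto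
  have "finite J" "fst ` J \<subseteq> {1..k}" by (auto simp: J)
  then have "\<exists>e' P'. stage h lam k r J fst 0 (insert l {..<l}) (n - l + 1 - 1) e' P'"
    using step r by (intro stage_step[OF st]) auto
  moreover have "n - l + 1 - 1 = n - Suc l + 1" using step by simp
  ultimately show ?case by (simp only: lessThan_Suc)
qed

section \<open>Connectedness of the colour classes\<close>

text \<open>Consecutive edges of a chain share a vertex, and these shared vertices form a
  walk.\<close>

lemma linked_imp_connected:
  assumes "(a, b) \<in> (linked K e \<alpha>)\<^sup>*" "a \<in> K" "u \<in># e a" "v \<in># e b"
    and E: "e ` K \<subseteq> set_mset E" and V: "\<And>j. j \<in> K \<Longrightarrow> set_mset (e j) \<subseteq> V"
  shows "(u, v) \<in> {(x, y). x \<in> V \<and> y \<in> V \<and> (\<exists>e\<in>#E. x \<in># e \<and> y \<in># e)}\<^sup>*"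
  using assms(1,4)
proof (induction arbitrary: v rule: rtrancl_induct)
  case base
  then show ?case using assms(2,3) E V by (intro r_into_rtrancl) blast
next
  case (step b d)
  then obtain w where w: "w \<in># e b" "w \<in># e d" "d \<in> K" by (auto simp: linked_def)
  have "(w, v) \<in> {(x, y). x \<in> V \<and> y \<in> V \<and> (\<exists>e\<in>#E. x \<in># e \<and> y \<in># e)}"
    using w step.prems E V by blast
  then show ?case using step.IH[OF w(1)] by (rule rtrancl_into_rtrancl[rotated])
qed

text \<open>For \<open>h = 1\<close> every edge has a single vertex, so no colour class on two or
  more vertices is connected; hence the condition \<open>h \<ge> 2 \<or> l = 1\<close> in the last
  clause. Writing \<open>card U + p = h\<close> avoids truncated subtraction for
  \<open>p > h\<close>.\<close>

theorem theorem3p2: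
  fixes n h lam k l :: nat and r :: "nat \<Rightarrow> nat"
  assumes "n > 0" and "h > 0" and "lam > 0" and "k > 0"
    and "\<forall>i\<in>{1..k}. r i > 0"
    and "n > h"
    and "\<forall>i\<in>{1..k}. r i \<ge> 2 \<and> h dvd r i * n"
    and "(\<Sum>i = 1..k. r i) = lam * ((n - 1) choose (h - 1))"
    and "1 \<le> l" and "l \<le> n"
  shows "\<exists>(V :: nat set) E \<alpha> C.
      hypergraph V E \<and> uniform_edges h E \<and> card V = l \<and> \<alpha> \<in> V \<and> edge_coloring k E C \<and>
      (\<forall>u\<in>V. \<forall>i\<in>{1..k}. vertex_degree (color_class C i) u =
         (if u = \<alpha> then r i * (n - l + 1) else r i)) \<and>
      (\<forall>p U. U \<subseteq> V - {\<alpha>} \<and> card U + p = h \<longrightarrow>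
         count E (replicate_mset p \<alpha> + mset_set U) = lam * ((n - l + 1) choose p)) \<and>
      (\<forall>i\<in>{1..k}. r i \<ge> 2 \<and> (h \<ge> 2 \<or> l = 1) \<longrightarrow> hypergraph_connected V (color_class C i))"
proof -
  define J where "J = (SIGMA i:{1..k}. {..<r i * n div h})"
  obtain e P where st: "stage h lam k r J fst 0 {..<l} (n - l + 1) e P"
    using stage_exists[OF \<open>h > 0\<close> assms(7,6,8) J_def assms(9,10)] by blast
  have J: "finite J" "fst ` J \<subseteq> {1..k}" by (auto simp: J_def)
  define V where "V = {..<l}"
  define K where "K i = {j\<in>J. fst j = i}" for i
  define E where "E = image_mset e (mset_set J)"
  define C where "C = image_mset (\<lambda>j. (e j, fst j)) (mset_set J)"
  have setE: "set_mset E = e ` J" using J by (simp add: E_def)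
  have form: "\<exists>p U. U \<subseteq> V - {0} \<and> card U + p = h \<and> e j = replicate_mset p 0 + mset_set U" if "j \<in> J" for j
    using st that unfolding stage_def V_def by blast
  have eV: "set_mset (e j) \<subseteq> V" "size (e j) = h" if j: "j \<in> J" for j
  proof -
    obtain p U where pU: "U \<subseteq> V - {0}" "card U + p = h" "e j = replicate_mset p 0 + mset_set U"
      using form[OF j] by blast
    have "finite U" using pU(1) by (rule finite_subset) (simp add: V_def)
    then show "set_mset (e j) \<subseteq> V" "size (e j) = h"
      using pU \<open>1 \<le> l\<close> by (auto simp: V_def split: if_splits)
  qed
  have cc: "color_class C i = image_mset e (mset_set (K i))" for i
    using J by (simp add: color_class_def C_def K_def filter_mset_image_mset multiset.map_comp comp_def)
  have deg: "vertex_degree (color_class C i) u = (if u = 0 then r i * (n - l + 1) else r i)"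
    if "u \<in> V" "i \<in> {1..k}" for u i
    using st that unfolding stage_def V_def cc vertex_degree_def K_def
    by (simp add: multiset.map_comp comp_def flip: sum_unfold_sum_mset)
  have countE: "count E t = card {j\<in>J. e j = t}" for t
  proof -
    have "e -` {t} \<inter> J = {j\<in>J. e j = t}" by auto
    then show ?thesis using J by (simp add: E_def count_image_mset)
  qed
  have conn: "hypergraph_connected V (color_class C i)" if i: "i \<in> {1..k}" and h: "2 \<le> h \<or> l = 1" for i
  proof (cases "l = 1")
    case True
    then have "V = {0}" by (auto simp: V_def)
    then show ?thesis by (simp add: hypergraph_connected_def)
  next
    case False
    then have "2 \<le> h" using h by simp
    then have w: "wings (K i) e 0 (n - l + 1) (r i) (P i)" and part: "partition_on (K i) (P i)"
      using st i unfolding stage_def K_def by blast+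
    have K: "finite (K i)" "K i \<subseteq> J" using J by (auto simp: K_def)
    have "(\<Sum>j\<in>K i. count (e j) u) = (if u = 0 then r i * (n - l + 1) else r i)" if "u \<in> V" for u
      using st that i unfolding stage_def V_def K_def by blast
    then have pos: "(\<Sum>j\<in>K i. count (e j) u) \<noteq> 0" if "u \<in> V" for u
      using assms(5) i that by auto
    \<comment> \<open>Positive degree puts \<open>u\<close> into an edge of the colour, and the
      block of that edge has an edge through 0, the vertex in the role of \<alpha>. Thus all
      vertices are joined to 0, whatever the number of blocks.\<close>
    have wing: "\<exists>a\<in>K i. \<exists>b\<in>K i. u \<in># e a \<and> 0 \<in># e b \<and>
        (a, b) \<in> (linked (K i) e 0)\<^sup>* \<and> (b, a) \<in> (linked (K i) e 0)\<^sup>*" if u: "u \<in> V" for u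
    proof -
      obtain a where a: "a \<in> K i" "u \<in># e a"
        using pos[OF u] by (metis not_in_iff sum.neutral)
      then obtain W where W: "W \<in> P i" "a \<in> W" using part by (auto simp: partition_on_def)
      then have "(\<Sum>j\<in>W. count (e j) 0) \<noteq> 0" using w unfolding wings_def by fastforce
      then obtain b where b: "b \<in> W" "0 \<in># e b" by (metis not_in_iff sum.neutral)
      have "b \<in> K i" using part W b by (auto simp: partition_on_def)
      moreover have "(a, b) \<in> (linked (K i) e 0)\<^sup>*" "(b, a) \<in> (linked (K i) e 0)\<^sup>*"
        using w W b(1) unfolding wings_def by blast+
      ultimately show ?thesis using a b(2) by blast
    qed
    define R where "R = {(x, y). x \<in> V \<and> y \<in> V \<and> (\<exists>e\<in>#color_class C i. x \<in># e \<and> y \<in># e)}"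
    have link: "(u, v) \<in> R\<^sup>*" if "(a, b) \<in> (linked (K i) e 0)\<^sup>*" "a \<in> K i" "u \<in># e a" "v \<in># e b" for a b u v
      unfolding R_def using that K eV
      by (intro linked_imp_connected[where K = "K i" and e = e and \<alpha> = 0]) (auto simp: cc)
    have "(u, v) \<in> R\<^sup>*" if "u \<in> V" "v \<in> V" for u v
    proof -
      have "(u, 0) \<in> R\<^sup>*" using wing[OF that(1)] link by metis
      moreover have "(0, v) \<in> R\<^sup>*" using wing[OF that(2)] link by metis
      ultimately show ?thesis by (rule rtrancl_trans)
    qed
    then show ?thesis unfolding hypergraph_connected_def R_def by blast
  qed
  have "hypergraph V E \<and> uniform_edges h E \<and> card V = l \<and> 0 \<in> V \<and> edge_coloring k E C"
    using eV J \<open>1 \<le> l\<close>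
    by (auto simp: hypergraph_def uniform_edges_def edge_coloring_def setE V_def C_def E_def
        multiset.map_comp comp_def)
  moreover have "count E (replicate_mset p 0 + mset_set U) = lam * ((n - l + 1) choose p)"
    if "U \<subseteq> V - {0} \<and> card U + p = h" for p U
    using st that unfolding stage_def V_def countE by blast
  ultimately show ?thesis using deg conn by blast
qed

end
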